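(* Let $r,\rho,h,w,I_{\rm s},J>0$, $c=\frac{\rho I_{\rm s}}{2w(I_{\rm s}+J)}$, and $\alpha,\beta>0$. Let $\varphi=(\varphi_1,\varphi_2)\colon[0,T]\to\mathbb{R}^2$ be any continuous, piecewise $C^1$ curve that traverses the rectangular loop with successive vertices $$(0,0)\to\left(\tfrac{\alpha}{2},\tfrac{\alpha}{2}\right)\to\left(\tfrac{\alpha+\beta}{2},\tfrac{\alpha-\beta}{2}\right)\to\left(\tfrac{\beta}{2},-\tfrac{\beta}{2}\right)\to(0,0)$$ along its straight edges in this order. Let $(R(t),\mathbf{x}(t))\in\mathsf{SO}(3)\times\mathbb{R}^2$ solve $$\dot R=\hat{\boldsymbol\omega}R,\qquad\boldsymbol\omega=\begin{bmatrix} -\frac{\rho}{2h}(\dot\varphi_1+\dot\varphi_2)\cos(c(\varphi_1-\varphi_2)) \\ -\frac{\rho}{2h}(\dot\varphi_1+\dot\varphi_2)\sin(c(\varphi_1-\varphi_2)) \\ -\frac{cJ}{I_{\rm s}}(\dot\varphi_1-\dot\varphi_2) \end{bmatrix},\qquad \dot{\mathbf{x}}=\frac{r\rho}{2h}(\dot\varphi_1+\dot\varphi_2)\begin{bmatrix} -\sin(c(\varphi_1-\varphi_2)) \\ \cos(c(\varphi_1-\varphi_2)) \end{bmatrix}.$$ Then $$R(T)=\exp\left(\beta\tfrac{cJ}{I_{\rm s}}\hat{\mathbf{e}}_3\right)\exp\left(\alpha\tfrac{\rho}{2h}\hat{\mathbf{n}}\right)\exp\left(-\beta\tfrac{cJ}{I_{\rm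 s}}\hat{\mathbf{e}}_3\right)\exp\left(-\alpha\tfrac{\rho}{2h}\hat{\mathbf{e}}_1\right)R(0),\qquad \mathbf{n}=\begin{bmatrix} \cos(c\beta) \\ \sin(c\beta) \\ 0 \end{bmatrix}.$$ In particular, $R(T)R(0)^{-1}$ does not depend on how the loop is parametrized. Moreover, if $\beta=2\pi/c$, then $\mathbf{x}(T)=\mathbf{x}(0)$.
   Context: For $\mathbf{a}=(a_1,a_2,a_3)\in\mathbb{R}^3$, $\hat{\mathbf{a}}=\begin{bmatrix} 0 & -a_3 & a_2 \\ a_3 & 0 & -a_1 \\ -a_2 & a_1 & 0 \end{bmatrix}\in\mathfrak{so}(3)$; $\mathbf{e}_1,\mathbf{e}_2,\mathbf{e}_3$ is the standard basis of $\mathbb{R}^3$ and $\exp$ is the matrix exponential. The equations are the rolling constraints of a spherical robot driven by two internal wheels with angles $\varphi_1,\varphi_2$ (taken in the covering space $\mathbb{R}^2$ of $\mathbb{S}^1\times\mathbb{S}^1$), orientation $R$, and center position $\mathbf{x}$. "Traverses the loop along its edges in this order" means there is a partition $0=t_0<t_1<t_2<t_3<t_4=T$ such that on $[t_{k-1},t_k]$ the curve stays in the $k$-th edge (a straight segment) and goes from its initial vertex to its terminal vertex. *)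

theory Defs
  imports "HOL-Analysis.Analysis"
begin

definition hat :: "real^3 \<Rightarrow> real^3^3" where
  "hat a = vector [vector [0, - (a$3), a$2],
                   vector [a$3, 0, - (a$1)],
                   vector [- (a$2), a$1, 0]]"

text \<open>The library's \<open>*\<close> and \<open>^\<close> on \<open>real^'n^'n\<close> act entrywise, so the powers in the
  exponential series are iterates of the matrix product \<open>**\<close>.\<close>

definition matrix_exp :: "real^'n^'n \<Rightarrow> real^'n^'n" where
  "matrix_exp A = (\<Sum>k. (1 / fact k) *\<^sub>R (((**) A ^^ k) (mat 1)))"

text \<open>The curve \<open>\<phi>\<close> on \<open>[0,T]\<close> runs through the vertices \<open>vs\<close> in order, staying on the
  straight edge between consecutive vertices. Motion along an edge need not be monotone.\<close>

definition traverses_polygon :: "(real \<Rightarrow> real^2) \<Rightarrow> real \<Rightarrow> (real^2) list \<Rightarrow> bool" where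
  "traverses_polygon \<phi> T vs \<longleftrightarrow>
     (\<exists>t :: nat \<Rightarrow> real. t 0 = 0 \<and> t (length vs - 1) = T \<and>
        (\<forall>k < length vs - 1.
           t k < t (k + 1) \<and> \<phi> (t k) = vs ! k \<and> \<phi> (t (k + 1)) = vs ! (k + 1) \<and>
           (\<forall>s \<in> {t k..t (k + 1)}. \<phi> s \<in> closed_segment (vs ! k) (vs ! (k + 1)))))"

definition rectangular_loop :: "real \<Rightarrow> real \<Rightarrow> (real^2) list" where
  "rectangular_loop \<alpha> \<beta> =
     [vector [0, 0], vector [\<alpha> / 2, \<alpha> / 2], vector [(\<alpha> + \<beta>) / 2, (\<alpha> - \<beta>) / 2],
      vector [\<beta> / 2, - (\<beta> / 2)], vector [0, 0]]"

text \<open>Right-hand sides of the rolling constraints, as functions of the wheel angles \<open>p\<close>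
  and the wheel velocities \<open>v\<close>.\<close>

definition angular_velocity ::
  "real \<Rightarrow> real \<Rightarrow> real \<Rightarrow> real \<Rightarrow> real \<Rightarrow> real^2 \<Rightarrow> real^2 \<Rightarrow> real^3" where
  "angular_velocity \<rho> h Is J c p v =
     vector [- (\<rho> / (2 * h)) * (v$1 + v$2) * cos (c * (p$1 - p$2)),
             - (\<rho> / (2 * h)) * (v$1 + v$2) * sin (c * (p$1 - p$2)),
             - (c * J / Is) * (v$1 - v$2)]"

definition center_velocity ::
  "real \<Rightarrow> real \<Rightarrow> real \<Rightarrow> real \<Rightarrow> real^2 \<Rightarrow> real^2 \<Rightarrow> real^2" where
  "center_velocity r \<rho> h c p v =
     (r * \<rho> / (2 * h) * (v$1 + v$2)) *\<^sub>R
       vector [- sin (c * (p$1 - p$2)), cos (c * (p$1 - p$2))]"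

text \<open>Since \<open>\<phi>\<close> is only piecewise \<open>C\<^sup>1\<close>, a solution is a continuous \<open>(R, x)\<close> satisfying the
  differential equations at all but finitely many times. The derivatives are two-sided;
  \<open>0\<close> and \<open>T\<close> may belong to the exceptional set, so values outside \<open>[0,T]\<close> do not matter.\<close>

definition rolling_motion ::
  "real \<Rightarrow> real \<Rightarrow> real \<Rightarrow> real \<Rightarrow> real \<Rightarrow> real \<Rightarrow> real \<Rightarrow>
   (real \<Rightarrow> real^2) \<Rightarrow> (real \<Rightarrow> real^3^3) \<Rightarrow> (real \<Rightarrow> real^2) \<Rightarrow> bool" where
  "rolling_motion r \<rho> h Is J c T \<phi> R x \<longleftrightarrow>
     (\<forall>t \<in> {0..T}. rotation_matrix (R t)) \<and>
     continuous_on {0..T} R \<and> continuous_on {0..T} x \<and>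
     (\<exists>S. finite S \<and> (\<forall>t \<in> {0..T} - S.
        \<phi> differentiable (at t) \<and>
        (R has_vector_derivative
           hat (angular_velocity \<rho> h Is J c (\<phi> t) (vector_derivative \<phi> (at t))) ** R t) (at t) \<and>
        (x has_vector_derivative
           center_velocity r \<rho> h c (\<phi> t) (vector_derivative \<phi> (at t))) (at t)))"

end

theory Submission
  imports Defs
begin

text \<open>On each edge one of \<open>\<phi>\<^sub>1 + \<phi>\<^sub>2\<close> and \<open>\<phi>\<^sub>1 - \<phi>\<^sub>2\<close> is constant, so that
  the axis of \<open>\<omega>\<close> is constant there and the equation reads \<open>R' = s' A R\<close> with a fixed
  matrix \<open>A\<close> and a scalar function \<open>s\<close> of time. Then \<open>exp (- s A) R\<close> has derivative zero,
  so \<open>R\<close> picks up the factor \<open>exp (\<Delta>s A)\<close>, whatever the parametrization. Likewise \<open>x\<close>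
  moves by \<open>\<Delta>s\<close> times a fixed vector on the two edges on which \<open>\<phi>\<^sub>1 + \<phi>\<^sub>2\<close> varies, and
  these two displacements cancel when \<open>c \<beta> = 2 \<pi>\<close>.\<close>

section \<open>The matrix exponential and its derivative along a line of matrices\<close>

lemma bounded_bilinear_matrix_mult:
  "bounded_bilinear ((**) :: real^'n^'m \<Rightarrow> real^'k^'n \<Rightarrow> real^'k^'m)"
  unfolding bilinear_conv_bounded_bilinear [symmetric] bilinear_def linear_iff
  by (simp add: vec_eq_iff matrix_matrix_mult_def sum.distrib sum_distrib_left algebra_simps)

text \<open>This supplies the product rule, continuity and termwise action on series for
  \<open>**\<close>.\<close>

interpretation matrix_mult:
  bounded_bilinear "(**) :: real^'n^'m \<Rightarrow> real^'k^'n \<Rightarrow> real^'k^'m"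
  by (rule bounded_bilinear_matrix_mult)

lemma matrix_power_scaleR:
  fixes A :: "real^'n^'n"
  shows "((**) (t *\<^sub>R A) ^^ k) (mat 1) = t ^ k *\<^sub>R ((**) A ^^ k) (mat 1)"
  by (induction k) (simp_all add: matrix_mult.scaleR_left matrix_mult.scaleR_right)

lemma matrix_power_commute:
  fixes A :: "real^'n^'n"
  shows "((**) A ^^ k) (mat 1) ** A = A ** ((**) A ^^ k) (mat 1)"
  by (induction k) (simp_all add: matrix_mul_assoc [symmetric])

lemma summable_matrix_exp:
  fixes A :: "real^'n^'n"
  shows "summable (\<lambda>k. (1 / fact k) *\<^sub>R ((**) A ^^ k) (mat 1))"
proof -
  \<comment> \<open>\<open>K\<close> bounds left multiplication by \<open>A\<close>, so the powers
    grow at most like \<open>K ^ k\<close>, and the scalar exponential series of \<open>K\<close>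
    dominates.\<close>
  obtain K where K: "K > 0" "norm (A ** B) \<le> norm B * K" for B :: "real^'n^'n"
    using bounded_linear.pos_bounded [OF matrix_mult.bounded_linear_right [of A]] by blast
  let ?N = "norm (mat 1 :: real^'n^'n)"
  have power_le: "norm (((**) A ^^ k) (mat 1)) \<le> ?N * K ^ k" for k
  proof (induction k)
    case (Suc k)
    have "norm (((**) A ^^ Suc k) (mat 1)) \<le> norm (((**) A ^^ k) (mat 1)) * K"
      using K(2) by simp
    also have "\<dots> \<le> (?N * K ^ k) * K"
      using Suc K(1) by (intro mult_right_mono) auto
    finally show ?case by (simp add: mult_ac)
  qed simp
  have "summable (\<lambda>k. ?N * (inverse (fact k) * K ^ k))"
    by (intro summable_mult summable_exp)
  then show ?thesis
  proof (rule summable_comparison_test')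
    fix k :: nat
    show "norm ((1 / fact k) *\<^sub>R ((**) A ^^ k) (mat 1)) \<le> ?N * (inverse (fact k) * K ^ k)"
      using mult_left_mono [OF power_le [of k], of "inverse (fact k)"]
      by (simp add: divide_inverse mult_ac)
  qed
qed

lemma matrix_exp_zero: "matrix_exp (0 :: real^'n^'n) = mat 1"
proof -
  have "((**) (0 :: real^'n^'n) ^^ k) (mat 1) = (if k = 0 then mat 1 else 0)" for k
    by (cases k) simp_all
  then have "matrix_exp (0 :: real^'n^'n)
      = (\<Sum>k. if k = 0 then (1 / fact k) *\<^sub>R mat 1 else 0)"
    unfolding matrix_exp_def by (intro suminf_cong) (simp only: split: if_split, simp)
  also have "\<dots> = mat 1"
    by (subst suminf_finite [of "{0}"]) auto
  finally show ?thesis .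
qed

lemma matrix_exp_commute:
  fixes A :: "real^'n^'n"
  shows "matrix_exp (t *\<^sub>R A) ** A = A ** matrix_exp (t *\<^sub>R A)"
  unfolding matrix_exp_def
    bounded_linear.suminf [OF matrix_mult.bounded_linear_left summable_matrix_exp]
    bounded_linear.suminf [OF matrix_mult.bounded_linear_right summable_matrix_exp]
  by (simp add: matrix_power_scaleR matrix_mult.scaleR_left matrix_mult.scaleR_right
      matrix_power_commute)

text \<open>Paired with a fixed \<open>b\<close>, the exponential becomes a scalar power series in
  \<open>t\<close>, which may be differentiated term by term. Letting \<open>b\<close> range over
  the basis recovers the matrix derivative.\<close>

lemma matrix_exp_has_vector_derivative:
  fixes A :: "real^'n^'n"
  shows "((\<lambda>t. matrix_exp (t *\<^sub>R A)) has_vector_derivative A ** matrix_exp (t *\<^sub>R A)) (at t)"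
proof -
  let ?P = "\<lambda>k. ((**) A ^^ k) (mat 1)"
  have "((\<lambda>t. matrix_exp (t *\<^sub>R A) \<bullet> b) has_real_derivative (A ** matrix_exp (t *\<^sub>R A)) \<bullet> b) (at t)"
    for b :: "real^'n^'n"
  proof -
    define a where "a k = (?P k \<bullet> b) / fact k" for k
    have eq: "((1 / fact k) *\<^sub>R ((**) (t *\<^sub>R A) ^^ k) (mat 1)) \<bullet> b = a k * t ^ k" for k t
      by (simp add: a_def matrix_power_scaleR)
    have sum: "summable (\<lambda>k. a k * t ^ k)" for t
      using bounded_linear.summable [OF bounded_linear_inner_left summable_matrix_exp [of "t *\<^sub>R A"], of b]
      unfolding eq .
    have exp_eq: "matrix_exp (t *\<^sub>R A) \<bullet> b = (\<Sum>k. a k * t ^ k)" for t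
      unfolding matrix_exp_def
        bounded_linear.suminf [OF bounded_linear_inner_left summable_matrix_exp] eq ..
    \<comment> \<open>The factor \<open>A\<close> raises the power to \<open>k + 1\<close>, and
      (k+1)/(k+1)! = 1/k!, so this is the k-th term of the differentiated series.\<close>
    have "(A ** ((1 / fact k) *\<^sub>R ((**) (t *\<^sub>R A) ^^ k) (mat 1))) \<bullet> b = diffs a k * t ^ k" for k
      by (simp add: a_def diffs_def matrix_power_scaleR matrix_mult.scaleR_right field_simps
          del: of_nat_Suc)
    then have "(A ** matrix_exp (t *\<^sub>R A)) \<bullet> b = (\<Sum>k. diffs a k * t ^ k)"
      unfolding matrix_exp_def
        bounded_linear.suminf [OF bounded_linear_compose
          [OF bounded_linear_inner_left matrix_mult.bounded_linear_right] summable_matrix_exp]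
      by simp
    then show ?thesis
      using termdiffs_strong_converges_everywhere [OF sum] by (simp add: exp_eq)
  qed
  then show ?thesis
    unfolding has_vector_derivative_def has_derivative_componentwise_within [of "\<lambda>t. matrix_exp (t *\<^sub>R A)"]
    by (simp add: has_field_derivative_def mult.commute [of _ "(A ** matrix_exp (t *\<^sub>R A)) \<bullet> _"])
qed

section \<open>Linear matrix equations with a fixed coefficient direction\<close>

lemma has_vector_derivative_zero_imp_eq:
  fixes f :: "real \<Rightarrow> 'a::banach"
  assumes "finite S" "a \<le> b" "continuous_on {a..b} f"
    and "\<And>t. t \<in> {a<..<b} - S \<Longrightarrow> (f has_vector_derivative 0) (at t)"
  shows "f b = f a"
  \<comment> \<open>This form of the fundamental theorem tolerates finitely many exceptional times,
    which continuity bridges; corners of \<phi> are absorbed there.\<close>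
  using fundamental_theorem_of_calculus_interior_strong [of S a b f "\<lambda>_. 0"] assms
    has_integral_unique [OF has_integral_0] by fastforce

lemma matrix_ode_invariant:
  fixes A :: "real^'n^'n" and Y :: "real \<Rightarrow> real^'n^'n"
  assumes "finite S" "a \<le> b" and s: "continuous_on {a..b} s" and Y: "continuous_on {a..b} Y"
    and s': "\<And>t. t \<in> {a<..<b} - S \<Longrightarrow> (s has_real_derivative s' t) (at t)"
    and Y': "\<And>t. t \<in> {a<..<b} - S \<Longrightarrow> (Y has_vector_derivative (s' t *\<^sub>R A) ** Y t) (at t)"
  shows "matrix_exp ((- s b) *\<^sub>R A) ** Y b = matrix_exp ((- s a) *\<^sub>R A) ** Y a"
proof (rule has_vector_derivative_zero_imp_eq [OF assms(1,2)])
  let ?E = "\<lambda>t. matrix_exp (t *\<^sub>R A)"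
  have "continuous_on UNIV ?E"
    using matrix_exp_has_vector_derivative has_vector_derivative_continuous continuous_at_imp_continuous_on
    by blast
  then have "continuous_on {a..b} (\<lambda>t. ?E (- s t))"
    by (rule continuous_on_compose2) (auto intro: continuous_intros s)
  then show "continuous_on {a..b} (\<lambda>t. ?E (- s t) ** Y t)"
    using Y by (rule matrix_mult.continuous_on)
next
  fix t assume t: "t \<in> {a<..<b} - S"
  let ?E = "matrix_exp ((- s t) *\<^sub>R A)"
  have "((\<lambda>u. - s u) has_vector_derivative - s' t) (at t)"
    using s' [OF t] by (auto simp: has_real_derivative_iff_has_vector_derivative intro: derivative_intros)
  from vector_diff_chain_at [OF this matrix_exp_has_vector_derivative]
  have "((\<lambda>u. matrix_exp ((- s u) *\<^sub>R A)) has_vector_derivative (- s' t) *\<^sub>R (A ** ?E)) (at t)"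
    by (simp add: o_def)
  from matrix_mult.has_vector_derivative [OF this Y' [OF t]]
  show "((\<lambda>u. matrix_exp ((- s u) *\<^sub>R A) ** Y u) has_vector_derivative 0) (at t)"
    \<comment> \<open>The product rule leaves \<open>?E ** (A ** Y t)\<close> and
      \<open>(A ** ?E) ** Y t\<close> with opposite factors \<open>s' t\<close>; they cancel because
      \<open>A\<close> commutes with its exponential.\<close>
    using matrix_exp_commute [of "- s t" A]
    by (simp add: matrix_mult.scaleR_left matrix_mult.scaleR_right matrix_mul_assoc matrix_mult.minus_left)
qed

text \<open>Apart from being an invariant of solutions, exp(-sA) Y can be tested on Y = exp(tA)
  itself with s = t: the product is constant, hence equal to its value at 0. This replaces a Cauchy
  product of series. The invariant runs forward in time, so the sign of \<open>t\<close> is handled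
  by passing to \<open>- A\<close> or to \<open>- t\<close>.\<close>

lemma matrix_exp_minus_mult:
  fixes A :: "real^'n^'n"
  shows "matrix_exp (t *\<^sub>R A) ** matrix_exp ((- t) *\<^sub>R A) = mat 1"
proof -
  have E: "matrix_exp ((- u) *\<^sub>R A) ** matrix_exp (u *\<^sub>R A) = mat 1" if "0 \<le> u" for u and A :: "real^'n^'n"
  proof -
    have "matrix_exp ((- u) *\<^sub>R A) ** matrix_exp (u *\<^sub>R A)
        = matrix_exp ((- 0) *\<^sub>R A) ** matrix_exp (0 *\<^sub>R A)"
      using matrix_exp_has_vector_derivative [of A]
      by (intro matrix_ode_invariant [OF finite.emptyI that, where s' = "\<lambda>_. 1"])
        (auto intro!: derivative_eq_intros continuous_intros continuous_at_imp_continuous_on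
          has_vector_derivative_continuous)
    then show ?thesis by (simp add: matrix_exp_zero)
  qed
  show ?thesis
  proof (cases "0 \<le> t")
    case True
    from E [OF this, of "- A"] show ?thesis by simp
  next
    case False
    then show ?thesis using E [of "- t" A] by simp
  qed
qed

lemma matrix_ode_solution:
  fixes A :: "real^'n^'n" and Y :: "real \<Rightarrow> real^'n^'n"
  assumes "finite S" "a \<le> b" and "continuous_on {a..b} s" and "continuous_on {a..b} Y"
    and "\<And>t. t \<in> {a<..<b} - S \<Longrightarrow> (s has_real_derivative s' t) (at t)"
    and "\<And>t. t \<in> {a<..<b} - S \<Longrightarrow> (Y has_vector_derivative (s' t *\<^sub>R A) ** Y t) (at t)"
  shows "Y b = matrix_exp ((s b - s a) *\<^sub>R A) ** Y a"
proof -
  \<comment> \<open>Shifting \<open>s\<close> to vanish at \<open>a\<close> turns the exponential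
    there into the identity, so no addition law for exponents is needed.\<close>
  have "matrix_exp ((- (s b - s a)) *\<^sub>R A) ** Y b = matrix_exp ((- (s a - s a)) *\<^sub>R A) ** Y a"
    using assms
    by (intro matrix_ode_invariant [where s = "\<lambda>t. s t - s a" and s' = s'])
      (auto intro!: derivative_eq_intros continuous_intros)
  then have "matrix_exp ((- (s b - s a)) *\<^sub>R A) ** Y b = Y a"
    by (simp add: matrix_exp_zero)
  then have "matrix_exp ((s b - s a) *\<^sub>R A) ** Y a
      = (matrix_exp ((s b - s a) *\<^sub>R A) ** matrix_exp ((- (s b - s a)) *\<^sub>R A)) ** Y b"
    by (simp only: matrix_mul_assoc [symmetric])
  then show ?thesis
    by (simp only: matrix_exp_minus_mult matrix_mul_lid)
qed

section \<open>Rolling along one edge and around the loop\<close>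

lemma hat_scaleR: "hat (u *\<^sub>R a) = u *\<^sub>R hat a"
  by (simp add: hat_def vec_eq_iff forall_3)

lemma hat_minus: "hat (- a) = - hat a"
  using hat_scaleR [of "-1" a] by simp

lemma closed_segment_linear_const:
  fixes f :: "'a::real_vector \<Rightarrow> real"
  assumes "linear f" "y \<in> closed_segment p q" "f p = d" "f q = d"
  shows "f y = d"
proof -
  obtain u where "y = (1 - u) *\<^sub>R p + u *\<^sub>R q"
    using assms(2) by (auto simp: closed_segment_def)
  then have "f y = (1 - u) * d + u * d"
    using assms by (simp add: linear_add linear_scale)
  then show ?thesis
    by (simp add: algebra_simps)
qed

text \<open>The functional \<open>g\<close> is the one frozen on the edge and \<open>f\<close> is
  the coordinate that varies. Using f(\<phi>(t)) as the clock, both velocities become the clock rate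
  times the fixed vectors \<open>e\<close> and \<open>u\<close>, so only the endpoint values of
  \<open>f\<close> survive. Both kinds of edge are instances, with the roles of sum and difference
  exchanged.\<close>

lemma rolling_segment:
  fixes \<phi> :: "real \<Rightarrow> real^2" and f g :: "real^2 \<Rightarrow> real"
  assumes motion: "rolling_motion r \<rho> h Is J c T \<phi> R x"
    and \<phi>: "continuous_on {0..T} \<phi>"
    and ab: "0 \<le> a" "a < b" "b \<le> T"
    and seg: "\<And>t. t \<in> {a..b} \<Longrightarrow> \<phi> t \<in> closed_segment p q" and "\<phi> a = p" "\<phi> b = q"
    and f: "linear f" and g: "linear g" "g p = d" "g q = d"
    and \<omega>: "\<And>y v. g y = d \<Longrightarrow> g v = 0 \<Longrightarrow> angular_velocity \<rho> h Is J c y v = f v *\<^sub>R e"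
    and u: "\<And>y v. g y = d \<Longrightarrow> g v = 0 \<Longrightarrow> center_velocity r \<rho> h c y v = f v *\<^sub>R u"
  shows "R b = matrix_exp ((f q - f p) *\<^sub>R hat e) ** R a \<and> x b = x a + (f q - f p) *\<^sub>R u"
proof -
  obtain S where S: "finite S" and der: "\<And>t. t \<in> {0..T} - S \<Longrightarrow> \<phi> differentiable (at t) \<and>
        (R has_vector_derivative
           hat (angular_velocity \<rho> h Is J c (\<phi> t) (vector_derivative \<phi> (at t))) ** R t) (at t) \<and>
        (x has_vector_derivative
           center_velocity r \<rho> h c (\<phi> t) (vector_derivative \<phi> (at t))) (at t)"
    using motion unfolding rolling_motion_def by blast
  have sub: "{a..b} \<subseteq> {0..T}" using ab by auto
  have R: "continuous_on {a..b} R" and x: "continuous_on {a..b} x"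
    using motion continuous_on_subset [OF _ sub] unfolding rolling_motion_def by blast+
  have bounded: "bounded_linear f" "bounded_linear g"
    using f g(1) by (simp_all add: linear_conv_bounded_linear)
  define s where "s t = f (\<phi> t)" for t
  define v where "v t = vector_derivative \<phi> (at t)" for t
  have s: "continuous_on {a..b} s"
    unfolding s_def by (intro bounded_linear.continuous_on [OF bounded(1)] continuous_on_subset [OF \<phi> sub])
  have g_\<phi>: "g (\<phi> t) = d" if "t \<in> {a..b}" for t
    using closed_segment_linear_const [OF g(1) seg [OF that] g(2,3)] .
  have \<phi>': "(\<phi> has_vector_derivative v t) (at t)" if "t \<in> {a<..<b} - S" for t
    using der [of t] that ab by (auto simp: v_def vector_derivative_works)
  have s': "(s has_vector_derivative f (v t)) (at t)" if "t \<in> {a<..<b} - S" for t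
    unfolding s_def using bounded_linear.has_vector_derivative [OF bounded(1) \<phi>' [OF that]] .
  have g_v: "g (v t) = 0" if t: "t \<in> {a<..<b} - S" for t
  proof -
    have "((\<lambda>t. g (\<phi> t)) has_vector_derivative g (v t)) (at t)"
      using bounded_linear.has_vector_derivative [OF bounded(2) \<phi>' [OF t]] .
    \<comment> \<open>Near an interior time the curve stays on the edge, where \<open>g\<close> is
      constant; comparing the two derivatives forces g(v) = 0.\<close>
    moreover have "((\<lambda>t. g (\<phi> t)) has_vector_derivative 0) (at t)"
      by (rule has_vector_derivative_transform_within_open [of "\<lambda>_. d" _ _ "{a<..<b}"])
        (use t g_\<phi> in auto)
    ultimately show ?thesis by (rule vector_derivative_unique_at)
  qed
  have "R b = matrix_exp ((s b - s a) *\<^sub>R hat e) ** R a"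
  proof (rule matrix_ode_solution [OF S _ s R, where s' = "\<lambda>t. f (v t)"])
    fix t assume t: "t \<in> {a<..<b} - S"
    show "(s has_real_derivative f (v t)) (at t)"
      using s' [OF t] by (simp add: has_real_derivative_iff_has_vector_derivative)
    show "(R has_vector_derivative (f (v t) *\<^sub>R hat e) ** R t) (at t)"
      using der [of t] t ab \<omega> [OF g_\<phi> g_v [OF t], of t] by (simp add: v_def hat_scaleR)
  qed (use ab in simp)
  moreover have "x b - s b *\<^sub>R u = x a - s a *\<^sub>R u"
  proof (rule has_vector_derivative_zero_imp_eq [OF S])
    show "continuous_on {a..b} (\<lambda>t. x t - s t *\<^sub>R u)"
      by (intro continuous_intros x s)
    fix t assume t: "t \<in> {a<..<b} - S"
    have "(x has_vector_derivative f (v t) *\<^sub>R u) (at t)"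
      using der [of t] t ab u [OF g_\<phi> g_v [OF t], of t] by (simp add: v_def)
    from has_vector_derivative_diff [OF this
        bounded_linear.has_vector_derivative [OF bounded_linear_scaleR_left [of u] s' [OF t]]]
    show "((\<lambda>t. x t - s t *\<^sub>R u) has_vector_derivative 0) (at t)" by simp
  qed (use ab in simp)
  ultimately show ?thesis
    using assms by (simp add: s_def algebra_simps)
qed

text \<open>The displacement is recorded for general \<beta>, so that closure of the path can be
  read off from sine and cosine at a full turn. The last conclusion makes \<open>R 0\<close>
  invertible when two motions are compared.\<close>

lemma rolling_rectangular_loop:
  fixes \<phi> x :: "real \<Rightarrow> real^2"
  assumes pC1: "\<phi> piecewise_C1_differentiable_on {0..T}"
    and loop: "traverses_polygon \<phi> T (rectangular_loop \<alpha> \<beta>)"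
    and motion: "rolling_motion r \<rho> h Is J c T \<phi> R x"
  shows "R T = matrix_exp ((\<beta> * (c * J / Is)) *\<^sub>R hat (axis 3 1))
                ** matrix_exp ((\<alpha> * (\<rho> / (2 * h))) *\<^sub>R hat (vector [cos (c * \<beta>), sin (c * \<beta>), 0]))
                ** matrix_exp ((- \<beta> * (c * J / Is)) *\<^sub>R hat (axis 3 1))
                ** matrix_exp ((- \<alpha> * (\<rho> / (2 * h))) *\<^sub>R hat (axis 1 1))
                ** R 0" (is ?rotation)
    and "x T = x 0 + (\<alpha> * (r * \<rho> / (2 * h))) *\<^sub>R vector [sin (c * \<beta>), 1 - cos (c * \<beta>)]"
      (is ?translation)
    and "rotation_matrix (R 0)"
proof -
  have len: "length (rectangular_loop \<alpha> \<beta>) - 1 = 4"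
    by (simp add: rectangular_loop_def)
  obtain t :: "nat \<Rightarrow> real" where t0: "t 0 = 0" and t4: "t 4 = T"
    and edge: "\<And>k. k < 4 \<Longrightarrow> t k < t (k + 1) \<and> \<phi> (t k) = rectangular_loop \<alpha> \<beta> ! k \<and>
      \<phi> (t (k + 1)) = rectangular_loop \<alpha> \<beta> ! (k + 1) \<and>
      (\<forall>s \<in> {t k..t (k + 1)}. \<phi> s \<in> closed_segment (rectangular_loop \<alpha> \<beta> ! k) (rectangular_loop \<alpha> \<beta> ! (k + 1)))"
    using loop len unfolding traverses_polygon_def by auto
  have \<phi>: "continuous_on {0..T} \<phi>"
    using pC1 by (simp add: piecewise_C1_differentiable_on_def)
  have t_less: "t 0 < t 1" "t 1 < t 2" "t 2 < t 3" "t 3 < t 4"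
    using edge [of 0] edge [of 1] edge [of 2] edge [of 3] by (simp_all add: eval_nat_numeral)
  show "rotation_matrix (R 0)"
    using motion t_less t0 t4 unfolding rolling_motion_def by auto
  define n where "n d = (vector [cos (c * d), sin (c * d), 0] :: real^3)" for d
  define m where "m d = (vector [- sin (c * d), cos (c * d)] :: real^2)" for d
  let ?\<sigma> = "\<lambda>y :: real^2. y$1 + y$2" and ?\<delta> = "\<lambda>y :: real^2. y$1 - y$2"
  let ?k = "\<rho> / (2 * h)" and ?l = "c * J / Is"
  have linear: "linear ?\<sigma>" "linear ?\<delta>"
    by (auto simp: linear_iff algebra_simps)
  have \<sigma>_velocity: "angular_velocity \<rho> h Is J c y v = ?\<sigma> v *\<^sub>R ((- ?k) *\<^sub>R n d)"
    "center_velocity r \<rho> h c y v = ?\<sigma> v *\<^sub>R ((r * ?k) *\<^sub>R m d)"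
    if "?\<delta> y = d" "?\<delta> v = 0" for y v d
    using that by (auto simp: angular_velocity_def center_velocity_def n_def m_def
        vec_eq_iff forall_3 forall_2)
  \<comment> \<open>When the wheel speeds sum to zero the robot spins in place about the vertical,
    which gives displacement vector 0.\<close>
  have \<delta>_velocity: "angular_velocity \<rho> h Is J c y v = ?\<delta> v *\<^sub>R ((- ?l) *\<^sub>R axis 3 1)"
    "center_velocity r \<rho> h c y v = ?\<delta> v *\<^sub>R 0" if "?\<sigma> v = 0" for y v
    using that by (simp_all add: angular_velocity_def center_velocity_def axis_def vec_eq_iff forall_3)
  note segment = rolling_segment [OF motion \<phi>]
  have \<sigma>_edge: "R (t (k + 1)) = matrix_exp ((?\<sigma> q - ?\<sigma> p) *\<^sub>R hat ((- ?k) *\<^sub>R n d)) ** R (t k) \<and>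
      x (t (k + 1)) = x (t k) + (?\<sigma> q - ?\<sigma> p) *\<^sub>R ((r * ?k) *\<^sub>R m d)"
    if "k < 4" "0 \<le> t k" "t (k + 1) \<le> T" "rectangular_loop \<alpha> \<beta> ! k = p"
      "rectangular_loop \<alpha> \<beta> ! (k + 1) = q" "?\<delta> p = d" "?\<delta> q = d" for k p q d
    by (rule segment [where g = ?\<delta> and d = d])
      (use that edge [OF that(1)] linear \<sigma>_velocity in auto)
  have \<delta>_edge: "R (t (k + 1)) = matrix_exp ((?\<delta> q - ?\<delta> p) *\<^sub>R hat ((- ?l) *\<^sub>R axis 3 1)) ** R (t k) \<and>
      x (t (k + 1)) = x (t k) + (?\<delta> q - ?\<delta> p) *\<^sub>R 0"
    if "k < 4" "0 \<le> t k" "t (k + 1) \<le> T" "rectangular_loop \<alpha> \<beta> ! k = p"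
      "rectangular_loop \<alpha> \<beta> ! (k + 1) = q" "?\<sigma> p = s" "?\<sigma> q = s" for k p q s
    by (rule segment [where g = ?\<sigma> and d = s])
      (use that edge [OF that(1)] linear \<delta>_velocity in auto)
  have 1: "R (t 1) = matrix_exp ((- \<alpha> * ?k) *\<^sub>R hat (n 0)) ** R 0"
    "x (t 1) = x 0 + (\<alpha> * (r * ?k)) *\<^sub>R m 0"
    using \<sigma>_edge [of 0, OF _ _ _ refl refl, of 0] t_less t0 t4
    by (simp_all add: rectangular_loop_def hat_scaleR hat_minus)
  have 2: "R (t 2) = matrix_exp ((- \<beta> * ?l) *\<^sub>R hat (axis 3 1)) ** R (t 1)" "x (t 2) = x (t 1)"
    using \<delta>_edge [of 1, OF _ _ _ refl refl, of \<alpha>] t_less t0 t4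
    by (simp_all add: rectangular_loop_def hat_scaleR hat_minus diff_divide_distrib add_divide_distrib
        eval_nat_numeral)
  have 3: "R (t 3) = matrix_exp ((\<alpha> * ?k) *\<^sub>R hat (n \<beta>)) ** R (t 2)"
    "x (t 3) = x (t 2) - (\<alpha> * (r * ?k)) *\<^sub>R m \<beta>"
    using \<sigma>_edge [of 2, OF _ _ _ refl refl, of \<beta>] t_less t0 t4
    by (simp_all add: rectangular_loop_def hat_scaleR hat_minus diff_divide_distrib add_divide_distrib
        eval_nat_numeral)
  have 4: "R T = matrix_exp ((\<beta> * ?l) *\<^sub>R hat (axis 3 1)) ** R (t 3)" "x T = x (t 3)"
    using \<delta>_edge [of 3, OF _ _ _ refl refl, of 0] t_less t0 t4
    by (simp_all add: rectangular_loop_def hat_scaleR hat_minus diff_divide_distrib add_divide_distrib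
        eval_nat_numeral)
  have n_0: "n 0 = axis 1 1"
    by (simp add: n_def axis_def vec_eq_iff forall_3)
  show ?rotation
    unfolding n_0 [symmetric] n_def [symmetric]
    using 1(1) 2(1) 3(1) 4(1) by (simp add: matrix_mul_assoc)
  show ?translation
    unfolding 4(2) 3(2) 2(2) 1(2)
    by (simp add: m_def vec_eq_iff forall_2 algebra_simps diff_divide_distrib)
qed

theorem mainTheorem4:
  fixes r \<rho> h w Is J c \<alpha> \<beta> T :: real
    and \<phi> x :: "real \<Rightarrow> real^2"
    and R :: "real \<Rightarrow> real^3^3"
  assumes "r > 0" "\<rho> > 0" "h > 0" "w > 0" "Is > 0" "J > 0"
    and c: "c = \<rho> * Is / (2 * w * (Is + J))"
    and "\<alpha> > 0" "\<beta> > 0"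
    and "\<phi> piecewise_C1_differentiable_on {0..T}"
    and "traverses_polygon \<phi> T (rectangular_loop \<alpha> \<beta>)"
    and "rolling_motion r \<rho> h Is J c T \<phi> R x"
  shows "R T = matrix_exp ((\<beta> * (c * J / Is)) *\<^sub>R hat (axis 3 1))
                ** matrix_exp ((\<alpha> * (\<rho> / (2 * h))) *\<^sub>R hat (vector [cos (c * \<beta>), sin (c * \<beta>), 0]))
                ** matrix_exp ((- \<beta> * (c * J / Is)) *\<^sub>R hat (axis 3 1))
                ** matrix_exp ((- \<alpha> * (\<rho> / (2 * h))) *\<^sub>R hat (axis 1 1))
                ** R 0 \<and>
         (\<forall>T' \<phi>' R' x'.
            \<phi>' piecewise_C1_differentiable_on {0..T'} \<longrightarrow>
            traverses_polygon \<phi>' T' (rectangular_loop \<alpha> \<beta>) \<longrightarrow>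
            rolling_motion r \<rho> h Is J c T' \<phi>' R' x' \<longrightarrow>
            R T ** matrix_inv (R 0) = R' T' ** matrix_inv (R' 0)) \<and>
         (\<beta> = 2 * pi / c \<longrightarrow> x T = x 0)"
proof -
  note holonomy = rolling_rectangular_loop
  have "R T ** matrix_inv (R 0) = R' T' ** matrix_inv (R' 0)"
    if "\<phi>' piecewise_C1_differentiable_on {0..T'}"
      "traverses_polygon \<phi>' T' (rectangular_loop \<alpha> \<beta>)"
      "rolling_motion r \<rho> h Is J c T' \<phi>' R' x'" for T' \<phi>' R' x'
  proof -
    have "B ** Q ** matrix_inv Q = B" if "rotation_matrix Q" for B Q :: "real^3^3"
    proof -
      \<comment> \<open>The transpose is a witness, so the choice made in \<open>matrix_inv\<close>
        yields a genuine two-sided inverse.\<close>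
      have "\<exists>Q'. Q ** Q' = mat 1 \<and> Q' ** Q = mat 1"
        using that by (auto simp: rotation_matrix_def orthogonal_matrix_def)
      then have "Q ** matrix_inv Q = mat 1"
        unfolding matrix_inv_def by (rule someI2_ex) simp
      then show ?thesis
        by (simp add: matrix_mul_assoc [symmetric])
    qed
    \<comment> \<open>After cancelling the initial orientations, both sides are the same product of
      four exponentials, which mentions neither curve.\<close>
    then show ?thesis
      unfolding holonomy(1) [OF assms(10-12)] holonomy(1) [OF that]
      using holonomy(3) [OF assms(10-12)] holonomy(3) [OF that] by simp
  qed
  moreover have "x T = x 0" if \<beta>: "\<beta> = 2 * pi / c"
  proof -
    \<comment> \<open>This rules out \<open>c = 0\<close>, where \<open>2 * pi / c\<close> would be
      0 by convention and c\<beta> would not be a full turn.\<close>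
    have "c > 0"
      using assms(1-6) by (simp add: c)
    then have "c * \<beta> = 2 * pi"
      using \<beta> by simp
    then show ?thesis
      using holonomy(2) [OF assms(10-12)] by (simp add: vec_eq_iff forall_2)
  qed
  ultimately show ?thesis
    using holonomy(1) [OF assms(10-12)] by blast
qed

end
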